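(* For every $x>\tfrac14$, $$h(x)=\sum_{k=0}^{\infty}\frac{Q_k}{x^{k+1}},\qquad\text{where}\quad Q_k=\sum_{p\text{ prime}}\frac{(p-1)^k}{p^{2k+2}}.$$ The series $\sum_{k\ge 0}Q_k/x^{k+1}$ converges absolutely for all $x>\tfrac14$.
   Context: For $x\in\bigl(\tfrac14,+\infty\bigr)$, $h(x)=\sum_{p\text{ prime}}\frac{1}{xp^2-p+1}$, the sum ranging over all prime numbers. *)

theory Defs
  imports "HOL-Analysis.Analysis" "HOL-Computational_Algebra.Primes"
begin

text \<open>
  Sums over all primes are unordered sums over the set of primes.  All terms of both
  sums are nonnegative (for \<open>x > 1/4\<close>), so this is the usual sum.
  \<^const>\<open>infsum\<close> returns 0 when the family is not summable; the lemmas below show that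
  this default value is never used in the intended range.
\<close>

definition h :: "real \<Rightarrow> real" where
  "h x = (\<Sum>\<^sub>\<infinity>p\<in>{p::nat. prime p}. 1 / (x * real p ^ 2 - real p + 1))"

definition Q :: "nat \<Rightarrow> real" where
  "Q k = (\<Sum>\<^sub>\<infinity>p\<in>{p::nat. prime p}. (real p - 1) ^ k / real p ^ (2 * k + 2))"

lemma inverse_square_summable_on_primes:
  "(\<lambda>p. c * (1 / real p ^ 2)) summable_on {p::nat. prime p}"
proof -
  have "summable (\<lambda>n. 1 / real n ^ 2)"
    using inverse_power_summable[of 2, where ?'a = real] by (simp add: field_simps)
  then have "(\<lambda>n. 1 / real n ^ 2) summable_on UNIV"
    by (subst summable_on_UNIV_nonneg_real_iff) auto
  then have "(\<lambda>n. 1 / real n ^ 2) summable_on {p::nat. prime p}"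
    by (rule summable_on_subset_banach) auto
  then show ?thesis by (rule summable_on_cmult_right)
qed

lemma h_denominator_ge:
  fixes x t :: real
  shows "(x - 1/4) * t ^ 2 \<le> x * t ^ 2 - t + 1"
proof -
  have "0 \<le> (t / 2 - 1) ^ 2" by simp
  then show ?thesis by (simp add: power2_eq_square algebra_simps)
qed

lemma h_summable:
  assumes "x > 1/4"
  shows "(\<lambda>p. 1 / (x * real p ^ 2 - real p + 1)) summable_on {p::nat. prime p}"
proof (rule summable_on_comparison_test
    [OF inverse_square_summable_on_primes[of "1 / (x - 1/4)"]])
  fix p :: nat assume "p \<in> {p. prime p}"
  then have "real p > 0" by (simp add: prime_gt_0_nat)
  then have pos: "(x - 1/4) * real p ^ 2 > 0" using assms by simp
  note le = h_denominator_ge[of x "real p"]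
  have "1 / (x * real p ^ 2 - real p + 1) \<le> 1 / ((x - 1/4) * real p ^ 2)"
    using pos le by (intro frac_le) auto
  then show "1 / (x * real p ^ 2 - real p + 1) \<le> 1 / (x - 1/4) * (1 / real p ^ 2)" by simp
  show "0 \<le> 1 / (x * real p ^ 2 - real p + 1)" using pos le by simp
qed

lemma Q_summable:
  "(\<lambda>p. (real p - 1) ^ k / real p ^ (2 * k + 2)) summable_on {p::nat. prime p}"
proof (rule summable_on_comparison_test[OF inverse_square_summable_on_primes[of 1]])
  fix p :: nat assume "p \<in> {p. prime p}"
  then have p: "real p \<ge> 1" using prime_ge_1_nat by auto
  then show "0 \<le> (real p - 1) ^ k / real p ^ (2 * k + 2)" by simp
  have "(real p - 1) ^ k \<le> real p ^ k" using p by (intro power_mono) auto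
  also have "\<dots> \<le> real p ^ (2 * k)" using p by (intro power_increasing) auto
  finally have "(real p - 1) ^ k / real p ^ (2 * k + 2) \<le> real p ^ (2 * k) / real p ^ (2 * k + 2)"
    by (intro divide_right_mono) auto
  also have "\<dots> = 1 * (1 / real p ^ 2)" using p by (simp add: power_add power2_eq_square)
  finally show "(real p - 1) ^ k / real p ^ (2 * k + 2) \<le> 1 * (1 / real p ^ 2)" .
qed

end

theory Submission imports Defs begin

text \<open>
  Each summand of \<^term>\<open>h x\<close> is the sum of a geometric series: dividing numerator and
  denominator by \<open>x p\<^sup>2\<close> gives
  \<open>1 / (x p\<^sup>2 - p + 1) = (1 / (x p\<^sup>2)) / (1 - r) = (1 / (x p\<^sup>2)) (1 + r + r\<^sup>2 + \<dots>)\<close>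
  with \<open>r = (p - 1) / (x p\<^sup>2)\<close>, and \<open>0 \<le> r < 1\<close> because the denominator is positive for
  \<open>x > 1/4\<close>. Summing the \<open>k\<close>-th terms of these series over \<open>p\<close> gives \<open>Q k / x ^ (k + 1)\<close>,
  so the identity is an exchange of two summations. All terms are nonnegative and the sum over
  \<open>k\<close> first and then over \<open>p\<close> is finite, being \<^term>\<open>h x\<close>; hence the double family is summable
  (Tonelli) and may be summed in either order.
\<close>

text \<open>
  The ratio \<open>(t - 1) / (x t\<^sup>2)\<close> is at most \<open>1 / (4 x)\<close>, since \<open>4 (t - 1) \<le> t\<^sup>2\<close> with equality
  at \<open>t = 2\<close>. This is where the bound \<open>1/4\<close> comes from; it is attained at the prime \<open>2\<close>.
\<close>

lemma geometric_expansion: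
  fixes x t :: real
  assumes x: "x > 1/4" and t: "t \<ge> 1"
  shows "((\<lambda>k. (t - 1) ^ k / t ^ (2 * k + 2) / x ^ (k + 1)) has_sum 1 / (x * t\<^sup>2 - t + 1)) UNIV"
proof -
  define r where "r = (t - 1) / (x * t\<^sup>2)"
  have xt: "x * t\<^sup>2 > 0" using x t by simp
  have "(x - 1/4) * t\<^sup>2 > 0" using x t by simp
  with h_denominator_ge[of x t] have den: "x * t\<^sup>2 - t + 1 > 0" by linarith
  have r0: "0 \<le> r" using t xt by (simp add: r_def)
  have r1: "r < 1" using xt den by (simp add: r_def divide_less_eq)
  have "(\<lambda>k. 1 / (x * t\<^sup>2) * r ^ k) sums (1 / (x * t\<^sup>2) * (1 / (1 - r)))"
    using r0 r1 by (intro sums_mult geometric_sums) auto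
  moreover have "1 / (x * t\<^sup>2) * (1 / (1 - r)) = 1 / (x * t\<^sup>2 - t + 1)"
  proof -
    have "x * t\<^sup>2 * r = t - 1"
      using x t by (simp add: r_def)
    then have "x * t\<^sup>2 * (1 - r) = x * t\<^sup>2 - t + 1"
      unfolding right_diff_distrib by linarith
    then show ?thesis by simp
  qed
  moreover have "1 / (x * t\<^sup>2) * r ^ k = (t - 1) ^ k / t ^ (2 * k + 2) / x ^ (k + 1)" for k
    by (simp add: r_def power_divide power_mult_distrib power_add power_mult power2_eq_square mult_ac)
  ultimately have "(\<lambda>k. (t - 1) ^ k / t ^ (2 * k + 2) / x ^ (k + 1)) sums (1 / (x * t\<^sup>2 - t + 1))"
    by simp
  then show ?thesis using x t by (intro sums_nonneg_imp_has_sum) auto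
qed

theorem theorem4p1:
  fixes x :: real
  assumes "x > 1/4"
  shows "h x = (\<Sum>k. Q k / x ^ (k + 1)) \<and> summable (\<lambda>k. \<bar>Q k / x ^ (k + 1)\<bar>)"
proof -
  let ?P = "{p::nat. prime p}"
  define f where "f = (\<lambda>(p::nat, k::nat). (real p - 1) ^ k / real p ^ (2 * k + 2) / x ^ (k + 1))"
  have prime_ge: "real p \<ge> 1" if "p \<in> ?P" for p
    using that prime_ge_1_nat by auto
  have f_nonneg: "f (p, k) \<ge> 0" if "p \<in> ?P" for p k
    using prime_ge[OF that] assms by (simp add: f_def)
  have rows: "((\<lambda>k. f (p, k)) has_sum 1 / (x * (real p)\<^sup>2 - real p + 1)) UNIV" if "p \<in> ?P" for p
    using geometric_expansion[OF assms prime_ge[OF that]] by (simp add: f_def)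
  have columns: "((\<lambda>p. f (p, k)) has_sum Q k / x ^ (k + 1)) ?P" for k
    unfolding f_def Q_def prod.case
    by (intro has_sum_divide_const has_sum_infsum Q_summable)
  have f_summable: "f summable_on ?P \<times> UNIV"
    using rows h_summable[OF assms] f_nonneg by (rule summable_on_SigmaI)
  have h_sum: "((\<lambda>p. 1 / (x * (real p)\<^sup>2 - real p + 1)) has_sum h x) ?P"
    unfolding h_def using h_summable[OF assms] by (rule has_sum_infsum)
  have "(f has_sum h x) (?P \<times> UNIV)"
    using rows h_sum f_summable by (rule has_sum_SigmaI)
  then have "((\<lambda>(k, p). f (p, k)) has_sum h x) (UNIV \<times> ?P)"
    by (rule has_sum_swap[THEN iffD1])
  then have "((\<lambda>k. Q k / x ^ (k + 1)) has_sum h x) UNIV"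
    by (rule has_sum_SigmaD) (simp only: prod.case columns)
  then have sums: "(\<lambda>k. Q k / x ^ (k + 1)) sums h x"
    by (rule has_sum_imp_sums)
  have "Q k / x ^ (k + 1) \<ge> 0" for k
    using columns f_nonneg by (rule has_sum_nonneg)
  then have "summable (\<lambda>k. \<bar>Q k / x ^ (k + 1)\<bar>)"
    using sums_summable[OF sums] by (simp only: abs_of_nonneg)
  with sums_unique[OF sums] show ?thesis by blast
qed

end
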